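(* Let $p(x)=\exp(\theta\cdot\phi(x))/Z$ be a probability distribution on $\{0,1\}^n$, where $\theta\in\mathbb{R}^d$, $\phi:\{0,1\}^n\to\mathbb{R}^d$ and $Z=\sum_{x\in\{0,1\}^n}\exp(\theta\cdot\phi(x))$. Let $A^{i,t}\in\{0,1\}^{i\times n}$ and $b^{i,t}\in\{0,1\}^i$, for $i\in[0,n]$ and $t\in[1,T]$, be random with i.i.d. Bernoulli$(\tfrac12)$ entries. Let $\mathcal{Q}$ be a family of probability distributions on $\{0,1\}^n$ such that $\mathcal{D}\subseteq\mathcal{Q}$, where $\mathcal{D}$ is the set of all point masses on $\{0,1\}^n$. Let $$\gamma^{i,t}=\exp\left(\max_{q\in\mathcal{Q}}\ \theta\cdot\sum_{x:\,A^{i,t}x=b^{i,t}\bmod 2}q(x)\phi(x)-\sum_{x:\,A^{i,t}x=b^{i,t}\bmod 2}q(x)\log q(x)\right)$$ be the optimal solutions of the projected variational inference problems. Then for all $i\in[0,n]$ and for all $T\ge 1$ the rescaled variational solution is a lower bound for $Z$ in expectation: $$\mathbb{E}\left[\frac1T\sum_{t=1}^T\gamma^{i,t}2^i\right]=\mathbb{E}[\gamma^{i,t}2^i]\le Z .$$ There also exists an $m$ such that for any $\delta>0$ and positive constant $\alpha\le 0.0042$, if $T\ge\frac1\alpha\log(n/\delta)$, then with probability at least $1-2\delta$ $$\frac1T\sum_{t=1}^T\gamma^{m,t}2^m\ \ge\ \frac{Z}{64(n+1)}$$ and $$4Z\ \ge\ \mathrm{Median}\left(\gamma^{m,1},\dots,\gamma^{m,T}\right)2^m\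 \ge\ \frac{Z}{32(n+1)} .$$
   Context: $p$ is the target distribution over $n$ binary variables, in exponential-family form with parameter $\theta$ and sufficient statistics $\phi$, and $Z$ is its partition function. Indices $i$, $t$, $m$ are integers, with $m\in[0,n]$. The distributions in $\mathcal{D}$ are those placing all probability mass on a single configuration $x_0\in\{0,1\}^n$. The projected problem for $(A,b)$ refers to the restriction of $p$ to $\{x: Ax=b\bmod 2\}$, renormalized: this is the distribution on that set proportional to $\exp(\theta\cdot\phi(x))$, with normalization constant $\sum_{x:\,Ax=b\bmod 2}\exp(\theta\cdot\phi(x))$. For $i=0$ there are no parity constraints.
   Formalization: The maximum defining γ ranges only over those q in Q supported on {x: Ax=b mod 2}, with γ=0 if there is no such q; taken over all of Q as printed, point masses off this set give γ≥1 and the bound E[γ2^i]≤Z fails. *)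

theory Defs
  imports "HOL-Probability.Probability" "HOL-Library.Z2"
begin

(* Configurations in {0,1}^n are vectors of type bit^'n with CARD('n) = n; arithmetic in the
   two-element field bit is arithmetic mod 2. *)

instance bit :: finite
proof
  have "(UNIV :: bit set) = {0, 1}"
    by (auto intro: bit_not_zero_iff[THEN iffD1])
  then show "finite (UNIV :: bit set)"
    by (metis finite.simps)
qed

definition partition_function :: "real^'d \<Rightarrow> (bit^'n \<Rightarrow> real^'d) \<Rightarrow> real" where
  "partition_function \<theta> \<phi> = (\<Sum>x\<in>UNIV. exp (\<theta> \<bullet> \<phi> x))"

definition point_masses :: "(bit^'n) pmf set" where
  "point_masses = range return_pmf"

(* A matrix with i rows is given by its rows A 0, ..., A (i - 1). *)
definition parity_solutions :: "nat \<Rightarrow> (nat \<Rightarrow> bit^'n) \<Rightarrow> (nat \<Rightarrow> bit) \<Rightarrow> (bit^'n) set" where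
  "parity_solutions i A b = {x. \<forall>r<i. (\<Sum>c\<in>UNIV. A r $ c * x $ c) = b r}"

(* The convention 0 log 0 = 0 holds here, because ln 0 = 0. *)
definition variational_objective ::
  "real^'d \<Rightarrow> (bit^'n \<Rightarrow> real^'d) \<Rightarrow> (bit^'n) set \<Rightarrow> (bit^'n) pmf \<Rightarrow> real" where
  "variational_objective \<theta> \<phi> S q =
     \<theta> \<bullet> (\<Sum>x\<in>S. pmf q x *\<^sub>R \<phi> x) - (\<Sum>x\<in>S. pmf q x * ln (pmf q x))"

(* The variational problem for the restriction of the target to S ranges over the members of the
   family that are distributions on S: any other q has infinite KL divergence from that restriction.
   If there are none, the maximum is -infinity and its exponential is 0; this happens when S is empty,
   but not when S is nonempty and Q contains all point masses. The objective is bounded above, and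
   the supremum is the maximum whenever the maximum is attained. *)
definition projected_optimum ::
  "real^'d \<Rightarrow> (bit^'n \<Rightarrow> real^'d) \<Rightarrow> (bit^'n) pmf set \<Rightarrow> (bit^'n) set \<Rightarrow> real" where
  "projected_optimum \<theta> \<phi> Q S =
     (let F = {q \<in> Q. set_pmf q \<subseteq> S}
      in if F = {} then 0 else exp (SUP q\<in>F. variational_objective \<theta> \<phi> S q))"

(* Inl (i, t, r, c) indexes the entry (r, c) of A^{i,t}, and Inr (i, t, r) the entry r of b^{i,t}.
   All of these entries are jointly independent. *)
definition random_parity_constraints ::
  "'w measure \<Rightarrow> nat \<Rightarrow> (nat \<Rightarrow> nat \<Rightarrow> 'w \<Rightarrow> nat \<Rightarrow> bit^'n) \<Rightarrow> (nat \<Rightarrow> nat \<Rightarrow> 'w \<Rightarrow> nat \<Rightarrow> bit) \<Rightarrow> bool"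
  where
  "random_parity_constraints M T A b \<longleftrightarrow>
     prob_space M \<and>
     (let I = {(i, t, r, c). i \<le> CARD('n) \<and> t \<in> {1..T} \<and> r < i}
              <+> {(i, t, r). i \<le> CARD('n) \<and> t \<in> {1..T} \<and> r < i};
          X = case_sum (\<lambda>(i, t, r, c) \<omega>. A i t \<omega> r $ c) (\<lambda>(i, t, r) \<omega>. b i t \<omega> r)
      in prob_space.indep_vars M (\<lambda>_. count_space UNIV) X I \<and>
         (\<forall>k\<in>I. distr M (count_space UNIV) (X k) =
                 measure_pmf (map_pmf of_bool (bernoulli_pmf (1/2)))))"

definition median :: "real list \<Rightarrow> real" where
  "median xs = (let ys = sort xs; k = length xs
                in (ys ! ((k - 1) div 2) + ys ! (k div 2)) / 2)"

end

theory Submission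
  imports Defs
begin

text \<open>Write \<open>w x = exp (\<theta> \<bullet> \<phi> x)\<close>. Gibbs' inequality and the point masses in \<open>\<Q>\<close> give, for a solution set
  \<open>S\<close>, the bounds \<open>max\<^sub>S w \<le> \<gamma> \<le> \<Sum>\<^sub>S w\<close>. Every configuration satisfies \<open>i\<close> random parity
  constraints with probability \<open>2\<^sup>-\<^sup>i\<close>, so \<open>\<gamma> 2\<^sup>i\<close> has expectation at most \<open>Z\<close>, and by Markov's
  inequality it exceeds \<open>4 Z\<close> with probability at most \<open>1/4\<close>. Conversely, a dyadic decomposition of
  \<open>Z\<close> yields \<open>k\<close> such that at least \<open>2\<^sup>k\<close> configurations have weight at least \<open>Z / ((n + 1) 2\<^sup>k)\<close>.
  For \<open>m = k - 5\<close> constraints at least \<open>32\<close> of them survive on average, and pairwise independence with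
  Chebyshev's inequality shows that one survives except with probability \<open>1/32\<close>. Finally,
  Hoeffding's inequality shows that each of the two failures, of probability at most \<open>1/4\<close> in one trial,
  affects half of the \<open>T\<close> trials with probability at most \<open>exp (- T / 8) \<le> \<delta>\<close>.\<close>

section \<open>Medians and averages under a strict majority\<close>

text \<open>It suffices to bound the upper of the two middle entries of the sorted list. If the
  entry at \<open>k div 2\<close> exceeded \<open>c\<close>, so would the \<open>k - k div 2\<close>
  entries from there on, at least half of the list.\<close>

lemma median_le:
  assumes "2 * length (filter (\<lambda>x. \<not> x \<le> c) xs) < length xs"
  shows "median xs \<le> c"
proof -
  define ys k where "ys = sort xs" and "k = length xs"
  have len: "length ys = k" and sorted: "sorted ys"
    by (auto simp: ys_def k_def)
  have k: "k > 0"
    using assms by (auto simp: k_def)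
  have filter: "length (filter P xs) = card {i. i < k \<and> P (ys ! i)}" for P
    unfolding len[symmetric] length_filter_conv_card[symmetric]
    by (metis ys_def mset_filter mset_sort size_mset)
  have "ys ! (k div 2) \<le> c"
  proof (rule ccontr)
    assume *: "\<not> ys ! (k div 2) \<le> c"
    have "{k div 2..<k} \<subseteq> {i. i < k \<and> \<not> ys ! i \<le> c}"
    proof
      fix i assume i: "i \<in> {k div 2..<k}"
      then have "ys ! (k div 2) \<le> ys ! i"
        using len by (intro sorted_nth_mono[OF sorted]) auto
      then show "i \<in> {i. i < k \<and> \<not> ys ! i \<le> c}"
        using * i by auto
    qed
    then have "k - k div 2 \<le> length (filter (\<lambda>x. \<not> x \<le> c) xs)"
      unfolding filter using card_mono[of "{i. i < k \<and> \<not> ys ! i \<le> c}" "{k div 2..<k}"] by simp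
    then show False
      using assms by (simp add: k_def)
  qed
  moreover have "ys ! ((k - 1) div 2) \<le> ys ! (k div 2)"
    using k len by (intro sorted_nth_mono[OF sorted]) auto
  ultimately show ?thesis
    by (simp add: median_def Let_def flip: ys_def k_def)
qed

text \<open>Dually, the lower middle entry decides: were it below \<open>c\<close>, so would be the
  entries at \<open>0\<close> to \<open>(k - 1) div 2\<close>, again at least half of the
  list.\<close>

lemma median_ge:
  assumes "2 * length (filter (\<lambda>x. \<not> c \<le> x) xs) < length xs"
  shows "c \<le> median xs"
proof -
  define ys k where "ys = sort xs" and "k = length xs"
  have len: "length ys = k" and sorted: "sorted ys"
    by (auto simp: ys_def k_def)
  have k: "k > 0"
    using assms by (auto simp: k_def)
  have filter: "length (filter P xs) = card {i. i < k \<and> P (ys ! i)}" for P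
    unfolding len[symmetric] length_filter_conv_card[symmetric]
    by (metis ys_def mset_filter mset_sort size_mset)
  have "c \<le> ys ! ((k - 1) div 2)"
  proof (rule ccontr)
    assume *: "\<not> c \<le> ys ! ((k - 1) div 2)"
    have "{..(k - 1) div 2} \<subseteq> {i. i < k \<and> \<not> c \<le> ys ! i}"
    proof
      fix i assume i: "i \<in> {..(k - 1) div 2}"
      then have "ys ! i \<le> ys ! ((k - 1) div 2)"
        using k len by (intro sorted_nth_mono[OF sorted]) auto
      then show "i \<in> {i. i < k \<and> \<not> c \<le> ys ! i}"
        using * k i by (auto simp: not_le)
    qed
    then have "(k - 1) div 2 + 1 \<le> length (filter (\<lambda>x. \<not> c \<le> x) xs)"
      unfolding filter using card_mono[of "{i. i < k \<and> \<not> c \<le> ys ! i}" "{..(k - 1) div 2}"] by simp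
    then show False
      using assms by (simp add: k_def)
  qed
  moreover have "ys ! ((k - 1) div 2) \<le> ys ! (k div 2)"
    using k len by (intro sorted_nth_mono[OF sorted]) auto
  ultimately show ?thesis
    by (simp add: median_def Let_def flip: ys_def k_def)
qed

lemma length_filter_map_upt:
  "length (filter P (map f [1..<Suc T])) = card {t \<in> {1..T}. P (f t)}"
proof -
  have "length (filter P (map f [1..<Suc T])) = length (filter (P \<circ> f) [1..<Suc T])"
    by (simp add: filter_map)
  also have "\<dots> = card ({t. (P \<circ> f) t} \<inter> set [1..<Suc T])"
    by (rule distinct_length_filter) simp
  also have "{t. (P \<circ> f) t} \<inter> set [1..<Suc T] = {t \<in> {1..T}. P (f t)}"
    by auto
  finally show ?thesis .
qed

text \<open>More than half of the terms are at least \<open>c\<close>, and nonnegativity allows the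
  others to be dropped. This loss of a factor 2 is why the average is bounded with 64 where the
  median has 32.\<close>

lemma average_ge_half:
  fixes f :: "nat \<Rightarrow> real"
  assumes "\<And>t. f t \<ge> 0" "c \<ge> 0" "2 * card {t \<in> {1..T}. \<not> c \<le> f t} < T"
  shows "c / 2 \<le> 1 / real T * (\<Sum>t = 1..T. f t)"
proof -
  have "card {1..T} = card ({t \<in> {1..T}. c \<le> f t} \<union> {t \<in> {1..T}. \<not> c \<le> f t})"
    by (rule arg_cong[where f = card]) auto
  also have "\<dots> = card {t \<in> {1..T}. c \<le> f t} + card {t \<in> {1..T}. \<not> c \<le> f t}"
    by (rule card_Un_disjoint) auto
  finally have "T = card {t \<in> {1..T}. c \<le> f t} + card {t \<in> {1..T}. \<not> c \<le> f t}"
    by simp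
  then have "real T / 2 * c \<le> real (card {t \<in> {1..T}. c \<le> f t}) * c"
    using assms by (intro mult_right_mono) auto
  also have "\<dots> = (\<Sum>t | t \<in> {1..T} \<and> c \<le> f t. c)"
    by simp
  also have "\<dots> \<le> (\<Sum>t | t \<in> {1..T} \<and> c \<le> f t. f t)"
    by (rule sum_mono) auto
  also have "\<dots> \<le> (\<Sum>t = 1..T. f t)"
    by (rule sum_mono2) (use assms in auto)
  finally show ?thesis
    using assms by (simp add: field_simps)
qed

section \<open>Dyadic decomposition of the total weight\<close>

text \<open>Otherwise, with \<open>u = Z / (n + 1)\<close>, fewer than \<open>2 ^ k\<close> elements
  weigh at least \<open>u / 2 ^ k\<close>, for each \<open>k \<le> n\<close>. Then a single element
  weighs less than \<open>u\<close>, and each of the \<open>n\<close> doublings up to the full type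
  adds at most \<open>u\<close>, so the total stays below \<open>(n + 1) * u = Z\<close>.\<close>

lemma heavy_level_exists:
  fixes w :: "'a::finite \<Rightarrow> real"
  assumes card: "CARD('a) = 2 ^ n" and Z: "Z = (\<Sum>x\<in>UNIV. w x)" "Z > 0"
  shows "\<exists>k\<le>n. 2 ^ k \<le> card {x. Z / ((real n + 1) * 2 ^ k) \<le> w x}"
proof (rule ccontr)
  assume "\<not> ?thesis"
  then have light: "card {x. Z / ((real n + 1) * 2 ^ k) \<le> w x} < 2 ^ k" if "k \<le> n" for k
    using that by (meson not_le)
  define u where "u = Z / (real n + 1)"
  have u: "u > 0"
    using Z by (simp add: u_def)
  \<comment> \<open>Quantifying over all sets of at most \<open>2 ^ k\<close> elements replaces
    sorting the elements by weight.\<close>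
  have "(\<Sum>x\<in>B. w x) < (real k + 1) * u" if "k \<le> n" "card B \<le> 2 ^ k" for k B
    using that
  proof (induction k arbitrary: B)
    case 0
    have "w x < u" for x
      using light[of 0] by (auto simp: u_def not_le)
    moreover have "B = {} \<or> (\<exists>x. B = {x})"
      using 0 card_1_singleton_iff[of B] by (auto simp: le_Suc_eq)
    ultimately show ?case
      using u by auto
  next
    case (Suc k)
    define H where "H = {x. Z / ((real n + 1) * 2 ^ k) \<le> w x}"
    show ?case
    proof (cases "card B \<le> 2 ^ k")
      case True
      then have "(\<Sum>x\<in>B. w x) < (real k + 1) * u"
        using Suc by simp
      then show ?thesis
        using u by (simp add: algebra_simps)
    next
      case False
      have "card H < 2 ^ k"
        using light[of k] Suc.prems by (simp add: H_def)
      then have "card (B \<inter> H) \<le> 2 ^ k"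
        by (meson card_mono finite inf_le2 less_imp_le order_trans)
      \<comment> \<open>The heavy part of \<open>B\<close> is padded to exactly \<open>2 ^ k\<close>
        elements: what remains is light and has at most \<open>2 ^ k\<close> elements.\<close>
      then obtain B' where B': "B \<inter> H \<subseteq> B'" "B' \<subseteq> B" "card B' = 2 ^ k"
        using exists_subset_between[of "B \<inter> H" "2 ^ k" B] False by auto
      have "(\<Sum>x\<in>B - B'. w x) \<le> of_nat (card (B - B')) * (u / 2 ^ k)"
        using B' by (intro sum_bounded_above) (auto simp: H_def u_def field_simps not_le)
      also have "\<dots> \<le> 2 ^ k * (u / 2 ^ k)"
      proof (rule mult_right_mono)
        have "card (B - B') \<le> 2 ^ k"
          using B' Suc.prems by (simp add: card_Diff_subset)
        then show "real (card (B - B')) \<le> 2 ^ k"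
          by (metis of_nat_le_iff of_nat_numeral of_nat_power)
      qed (use u in simp)
      finally have "(\<Sum>x\<in>B - B'. w x) \<le> u"
        by simp
      moreover have "(\<Sum>x\<in>B'. w x) < (real k + 1) * u"
        using Suc B' by simp
      moreover have "(\<Sum>x\<in>B. w x) = (\<Sum>x\<in>B - B'. w x) + (\<Sum>x\<in>B'. w x)"
        using B' by (intro sum.subset_diff) auto
      ultimately show ?thesis
        by (simp add: algebra_simps)
    qed
  qed
  from this[of n UNIV] show False
    using card Z by (simp add: u_def)
qed

section \<open>Bounds on the projected optimum\<close>

text \<open>Gibbs' inequality. Each term is estimated by \<open>ln y \<le> y - 1\<close> at
  \<open>y = w x / (pmf q x * W)\<close>; the corrections \<open>w x / W - pmf q x\<close> sum to
  zero, because the support condition makes \<open>pmf q\<close> sum to 1 over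
  \<open>S\<close>.\<close>

lemma variational_objective_le:
  assumes q: "set_pmf q \<subseteq> S"
  shows "variational_objective \<theta> \<phi> S q \<le> ln (\<Sum>x\<in>S. exp (\<theta> \<bullet> \<phi> x))"
proof -
  define w W where "w = (\<lambda>x. exp (\<theta> \<bullet> \<phi> x))" and "W = (\<Sum>x\<in>S. w x)"
  have "S \<noteq> {}"
    using q set_pmf_not_empty[of q] by auto
  then have W: "W > 0"
    by (auto simp: W_def w_def intro!: sum_pos)
  have sum1: "(\<Sum>x\<in>S. pmf q x) = 1"
    using q by (intro sum_pmf_eq_1) auto
  have "variational_objective \<theta> \<phi> S q = (\<Sum>x\<in>S. pmf q x * (ln (w x) - ln (pmf q x)))"
    by (simp add: variational_objective_def w_def inner_sum_right right_diff_distrib sum_subtractf)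
  also have "\<dots> \<le> (\<Sum>x\<in>S. pmf q x * ln W + (w x / W - pmf q x))"
  proof (rule sum_mono)
    fix x
    have wx: "w x > 0"
      by (simp add: w_def)
    show "pmf q x * (ln (w x) - ln (pmf q x)) \<le> pmf q x * ln W + (w x / W - pmf q x)"
    proof (cases "pmf q x = 0")
      case True
      then show ?thesis
        using wx W by simp
    next
      case False
      then have pos: "pmf q x > 0"
        by (simp add: pmf_pos)
      have "ln (w x / (pmf q x * W)) \<le> w x / (pmf q x * W) - 1"
        using pos wx W by (intro ln_le_minus_one) auto
      then have "pmf q x * (ln (w x) - ln (pmf q x) - ln W) \<le> pmf q x * (w x / (pmf q x * W) - 1)"
        using pos wx W by (intro mult_left_mono) (auto simp: ln_div ln_mult)
      also have "\<dots> = w x / W - pmf q x"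
        using pos W by (simp add: field_simps)
      finally show ?thesis
        by (simp add: algebra_simps)
    qed
  qed
  also have "\<dots> = ln W"
    using W sum1
    by (simp add: sum.distrib sum_subtractf flip: sum_distrib_right sum_divide_distrib W_def)
  finally show ?thesis
    by (simp add: W_def w_def)
qed

text \<open>Boundedness is what makes the real supremum in \<open>projected_optimum\<close> dominate
  the objective of each feasible \<open>q\<close>.\<close>

lemma bdd_above_variational_objective:
  "bdd_above (variational_objective \<theta> \<phi> S ` {q \<in> Q. set_pmf q \<subseteq> S})"
  by (intro bdd_aboveI2) (auto intro: variational_objective_le)

lemma projected_optimum_nonneg: "0 \<le> projected_optimum \<theta> \<phi> Q S"
  by (simp add: projected_optimum_def Let_def)

lemma projected_optimum_le: "projected_optimum \<theta> \<phi> Q S \<le> (\<Sum>x\<in>S. exp (\<theta> \<bullet> \<phi> x))"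
proof (cases "{q \<in> Q. set_pmf q \<subseteq> S} = {}")
  case True
  then show ?thesis
    unfolding projected_optimum_def Let_def by (simp add: sum_nonneg)
next
  case False
  then have "S \<noteq> {}"
    using set_pmf_not_empty by fastforce
  then have "(\<Sum>x\<in>S. exp (\<theta> \<bullet> \<phi> x)) > 0"
    by (intro sum_pos) auto
  moreover have "(SUP q\<in>{q \<in> Q. set_pmf q \<subseteq> S}. variational_objective \<theta> \<phi> S q)
      \<le> ln (\<Sum>x\<in>S. exp (\<theta> \<bullet> \<phi> x))"
    using False by (intro cSUP_least) (auto intro: variational_objective_le)
  ultimately show ?thesis
    using False by (simp add: projected_optimum_def Let_def ln_ge_iff)
qed

text \<open>The point mass at \<open>x\<close> is feasible, has entropy zero and mean statistic
  \<open>\<phi> x\<close>.\<close>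

lemma projected_optimum_ge:
  assumes "point_masses \<subseteq> Q" "x \<in> S"
  shows "exp (\<theta> \<bullet> \<phi> x) \<le> projected_optimum \<theta> \<phi> Q S"
proof -
  define F where "F = {q \<in> Q. set_pmf q \<subseteq> S}"
  have mem: "return_pmf x \<in> F"
    using assms by (auto simp: F_def point_masses_def)
  have "(\<Sum>y\<in>S. pmf (return_pmf x) y * ln (pmf (return_pmf x) y)) = 0"
    by (intro sum.neutral) (auto simp: pmf_return indicator_def)
  moreover have "(\<Sum>y\<in>S. pmf (return_pmf x) y *\<^sub>R \<phi> y) = (\<Sum>y\<in>S. if x = y then \<phi> y else 0)"
    by (intro sum.cong) (auto simp: pmf_return)
  ultimately have "variational_objective \<theta> \<phi> S (return_pmf x) = \<theta> \<bullet> \<phi> x"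
    using assms(2) by (simp add: variational_objective_def)
  then have "\<theta> \<bullet> \<phi> x \<le> (SUP q\<in>F. variational_objective \<theta> \<phi> S q)"
    using cSUP_upper[OF mem, of "variational_objective \<theta> \<phi> S"]
      bdd_above_variational_objective[of \<theta> \<phi> S Q] by (simp add: F_def)
  then show ?thesis
    using mem by (auto simp: projected_optimum_def Let_def F_def)
qed

section \<open>Random solution sets and pairwise independence\<close>

text \<open>A model on a fixed finite space: a system is a uniformly random extensional function
  from row indices to pairs of a row and its right-hand side. Probabilities become counts that do
  not depend on the space \<open>M\<close>, so \<open>m\<close> can be chosen before
  \<open>M\<close>.\<close>

definition random_solutions :: "nat \<Rightarrow> (bit^'n) set pmf" where
  "random_solutions i = map_pmf (\<lambda>g. parity_solutions i (fst \<circ> g) (snd \<circ> g))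
     (pmf_of_set ({..<i} \<rightarrow>\<^sub>E (UNIV :: ((bit^'n) \<times> bit) set)))"

lemma card_bit [simp]: "CARD(bit) = 2"
proof -
  have "(UNIV :: bit set) = {0, 1}"
    by (auto intro: bit_not_zero_iff[THEN iffD1])
  then show ?thesis
    by (metis card_2_iff zero_neq_one)
qed

definition parity :: "bit^'n \<Rightarrow> bit^'n \<Rightarrow> bit" where
  "parity a x = (\<Sum>c\<in>UNIV. a $ c * x $ c)"

lemma mem_parity_solutions:
  "x \<in> parity_solutions i A b \<longleftrightarrow> (\<forall>r<i. parity (A r) x = b r)"
  by (simp only: parity_solutions_def parity_def mem_Collect_eq)

lemma parity_add_left: "parity (a + b) x = parity a x + parity b x"
  by (simp only: parity_def vector_add_component distrib_right sum.distrib)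

lemma parity_axis: "parity (axis c 1) x = x $ c"
proof -
  have "parity (axis c 1) x = (\<Sum>d\<in>UNIV. if d = c then x $ d else 0)"
    unfolding parity_def by (intro sum.cong) (auto simp: axis_def)
  then show ?thesis
    by simp
qed

lemma card_constraint_systems:
  "card ({..<i} \<rightarrow>\<^sub>E (UNIV :: ((bit^'n) \<times> bit) set)) = 2 ^ (i * (CARD('n) + 1))"
  by (simp add: card_PiE card_prod power_mult_distrib power_add mult.commute flip: power_mult)

lemma constraint_systems_finite_nonempty:
  fixes i :: nat
  shows "finite ({..<i} \<rightarrow>\<^sub>E (UNIV :: ((bit^'n) \<times> bit) set))"
  "{..<i} \<rightarrow>\<^sub>E (UNIV :: ((bit^'n) \<times> bit) set) \<noteq> {}"
  by (auto intro!: finite_PiE simp: PiE_eq_empty_iff)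

text \<open>A system satisfied on all of \<open>X\<close> is an arbitrary choice, row by row, of
  pairs satisfied on \<open>X\<close>, so counting gives a power. One-point and two-point sets
  \<open>X\<close> yield the first and second moments.\<close>

lemma prob_subset_random_solutions:
  fixes X :: "(bit^'n) set"
  shows "measure_pmf.prob (random_solutions i) {S. X \<subseteq> S} =
    (real (card {(a, \<beta>). \<forall>x\<in>X. parity a x = \<beta>}) / 2 ^ (CARD('n) + 1)) ^ i"
proof -
  define R where "R = {(a, \<beta>). \<forall>x\<in>X. parity a x = (\<beta> :: bit)}"
  have R_iff: "p \<in> R \<longleftrightarrow> (\<forall>x\<in>X. parity (fst p) x = snd p)" for p
    by (simp add: R_def case_prod_beta)
  have "({..<i} \<rightarrow>\<^sub>E UNIV) \<inter> {g. X \<subseteq> parity_solutions i (fst \<circ> g) (snd \<circ> g)} = {..<i} \<rightarrow>\<^sub>E R"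
    unfolding set_eq_iff Int_iff PiE_iff mem_Collect_eq subset_iff mem_parity_solutions R_iff o_apply
    by blast
  moreover have "card ({..<i} \<rightarrow>\<^sub>E R) = card R ^ i"
    by (simp add: card_PiE)
  moreover have "card ({..<i} \<rightarrow>\<^sub>E (UNIV :: ((bit^'n) \<times> bit) set)) = (2 ^ (CARD('n) + 1)) ^ i"
    unfolding card_constraint_systems by (metis power_mult mult.commute)
  ultimately show ?thesis
    unfolding R_def[symmetric] random_solutions_def
    by (simp add: vimage_def measure_pmf_of_set constraint_systems_finite_nonempty power_divide)
qed

text \<open>Each \<open>a\<close> admits exactly one \<open>\<beta>\<close>, namely
  \<open>parity a x\<close>, so half of the pairs qualify in each row.\<close>

lemma prob_mem_random_solutions:
  fixes x :: "bit^'n"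
  shows "measure_pmf.prob (random_solutions i) {S. x \<in> S} = 1 / 2 ^ i"
proof -
  have "{(a, \<beta>). \<forall>y\<in>{x}. parity a y = \<beta>} = range (\<lambda>a. (a, parity a x))"
    by auto
  also have "card \<dots> = 2 ^ CARD('n)"
    by (subst card_image) (auto simp: inj_on_def)
  finally show ?thesis
    using prob_subset_random_solutions[of i "{x}"] by (simp add: power_one_over)
qed

text \<open>Flipping the entry of \<open>a\<close> at a position where \<open>x\<close> and \<open>y\<close> differ exchanges the vectors with
  \<open>a \<bullet> x = a \<bullet> y\<close> and those with \<open>a \<bullet> x \<noteq> a \<bullet> y\<close>.\<close>
lemma card_equal_parities:
  fixes x y :: "bit^'n"
  assumes "x \<noteq> y"
  shows "2 * card {a :: bit^'n. parity a x = parity a y} = 2 ^ CARD('n)"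
proof -
  obtain c where c: "x $ c \<noteq> y $ c"
    using assms by (auto simp: vec_eq_iff)
  define E :: "(bit^'n) set"
    where "E = {a. parity a x = parity a y}"
  define flip :: "bit^'n \<Rightarrow> bit^'n" where "flip a = a + axis c 1" for a
  have two: "b + b = 0" for b :: bit
    by (cases b) auto
  have flip_flip: "flip (flip a) = a" for a
    by (simp add: flip_def vec_eq_iff add.assoc two)
  have "parity (flip a) z = parity a z + z $ c" for a z
    by (simp add: flip_def parity_add_left parity_axis)
  moreover have "s + x $ c = t + y $ c \<longleftrightarrow> s \<noteq> t" for s t
    using c by (cases s; cases t; cases "x $ c"; cases "y $ c") auto
  ultimately have flip_E: "flip a \<in> E \<longleftrightarrow> a \<notin> E" for a
    by (simp add: E_def)
  have "bij_betw flip E (- E)"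
    by (rule bij_betw_byWitness[where f' = flip]) (auto simp: flip_flip flip_E)
  then have "card E = card (- E)"
    by (rule bij_betw_same_card)
  moreover have "card E + card (- E) = CARD(bit^'n)"
    by (subst card_Un_disjoint[symmetric]) auto
  ultimately show ?thesis
    by (simp add: flip: E_def)
qed

text \<open>In each row the parities of \<open>x\<close> and \<open>y\<close> must agree, which half
  of the vectors \<open>a\<close> achieve, and then \<open>\<beta>\<close> is forced: a quarter of
  the pairs remains. Since \<open>1 / 4 ^ i\<close> is the square of \<open>1 / 2 ^ i\<close>,
  survival is pairwise independent.\<close>

lemma prob_pair_random_solutions:
  fixes x y :: "bit^'n"
  assumes "x \<noteq> y"
  shows "measure_pmf.prob (random_solutions i) {S. x \<in> S \<and> y \<in> S} = 1 / 4 ^ i"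
proof -
  have "{(a, \<beta>). \<forall>z\<in>{x, y}. parity a z = \<beta>}
      = (\<lambda>a. (a, parity a x)) `
          {a. parity a x = parity a y}"
    by auto
  also have "card \<dots> = card {a. parity a x = parity a y}"
    by (rule card_image) (auto simp: inj_on_def)
  finally have "4 * real (card {(a, \<beta>). \<forall>z\<in>{x, y}. parity a z = \<beta>}) = 2 * 2 ^ CARD('n)"
    using arg_cong[where f = real, OF card_equal_parities[OF assms]] by simp
  then have "real (card {(a, \<beta>). \<forall>z\<in>{x, y}. parity a z = \<beta>}) / 2 ^ (CARD('n) + 1) = 1 / 4"
    by (simp add: field_simps)
  then show ?thesis
    unfolding prob_subset_random_solutions[of i "{x, y}", simplified insert_subset empty_subsetI simp_thms]
    by (simp only: power_one_over)
qed

section \<open>Bounds for a single trial\<close>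

text \<open>Linearity of expectation: each configuration contributes its weight times its survival
  probability \<open>1 / 2 ^ i\<close>.\<close>

lemma expectation_weight_random_solutions:
  fixes w :: "bit^'n \<Rightarrow> real"
  shows "measure_pmf.expectation (random_solutions i) (\<lambda>S. \<Sum>x\<in>S. w x) * 2 ^ i = (\<Sum>x\<in>UNIV. w x)"
proof -
  have "(\<Sum>x\<in>S. w x) = (\<Sum>x\<in>UNIV. w x * indicator {S. x \<in> S} S)" for S
    by (simp add: indicator_def sum.If_cases if_distrib[where f = "(*) _"] cong: if_cong)
  then have "measure_pmf.expectation (random_solutions i) (\<lambda>S. \<Sum>x\<in>S. w x)
      = measure_pmf.expectation (random_solutions i) (\<lambda>S. \<Sum>x\<in>UNIV. w x * indicator {S. x \<in> S} S)"
    by presburger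
  also have "\<dots> = (\<Sum>x\<in>UNIV. measure_pmf.expectation (random_solutions i) (\<lambda>S. w x * indicator {S. x \<in> S} S))"
    by (intro Bochner_Integration.integral_sum integrable_measure_pmf_finite) auto
  also have "\<dots> = (\<Sum>x\<in>UNIV. w x * measure_pmf.prob (random_solutions i) {S. x \<in> S})"
    by simp
  finally show ?thesis
    by (simp add: prob_mem_random_solutions sum_distrib_right)
qed

lemma expectation_projected_optimum_le:
  fixes \<phi> :: "bit^'n \<Rightarrow> real^'d"
  shows "measure_pmf.expectation (random_solutions i) (projected_optimum \<theta> \<phi> Q) * 2 ^ i
    \<le> partition_function \<theta> \<phi>"
proof -
  have "measure_pmf.expectation (random_solutions i) (projected_optimum \<theta> \<phi> Q)
      \<le> measure_pmf.expectation (random_solutions i) (\<lambda>S. \<Sum>x\<in>S. exp (\<theta> \<bullet> \<phi> x))"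
    by (intro integral_mono projected_optimum_le integrable_measure_pmf_finite) auto
  then have "measure_pmf.expectation (random_solutions i) (projected_optimum \<theta> \<phi> Q) * 2 ^ i
      \<le> measure_pmf.expectation (random_solutions i) (\<lambda>S. \<Sum>x\<in>S. exp (\<theta> \<bullet> \<phi> x)) * 2 ^ i"
    by (rule mult_right_mono) simp
  then show ?thesis
    unfolding expectation_weight_random_solutions by (simp add: partition_function_def)
qed

text \<open>The Chebyshev inequality in the form \<open>[N = 0] \<le> (1 - N / \<mu>)\<^sup>2\<close> for the number \<open>N\<close> of
  elements of \<open>H\<close> that survive, whose mean is \<open>\<mu> = |H| / 2\<^sup>i\<close> and whose second moment is at most
  \<open>\<mu> + \<mu>\<^sup>2\<close> by pairwise independence.\<close>
lemma prob_no_solution_in: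
  fixes H :: "(bit^'n) set"
  assumes "H \<noteq> {}"
  shows "measure_pmf.prob (random_solutions i) {S. S \<inter> H = {}} \<le> 2 ^ i / real (card H)"
proof -
  let ?P = "random_solutions i :: (bit^'n) set pmf"
  define \<mu> where "\<mu> = real (card H) / 2 ^ i"
  have \<mu>: "\<mu> > 0"
    using assms by (simp add: \<mu>_def card_gt_0_iff)
  define N where "N S = (\<Sum>x\<in>H. indicator {S. x \<in> S} S :: real)" for S
  have integrable: "integrable ?P f" for f :: "(bit^'n) set \<Rightarrow> real"
    by (rule integrable_measure_pmf_finite) auto
  have "measure_pmf.expectation ?P N = (\<Sum>x\<in>H. measure_pmf.prob ?P {S. x \<in> S})"
    unfolding N_def by (subst Bochner_Integration.integral_sum) (auto simp: integrable)
  then have first: "measure_pmf.expectation ?P N = \<mu>"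
    by (simp add: prob_mem_random_solutions \<mu>_def)
  have "N S ^ 2 = (\<Sum>x\<in>H. \<Sum>y\<in>H. indicator {S. x \<in> S \<and> y \<in> S} S)" for S
    unfolding N_def power2_eq_square sum_product
    by (intro sum.cong) (auto simp: indicator_def)
  then have "measure_pmf.expectation ?P (\<lambda>S. N S ^ 2)
      = (\<Sum>x\<in>H. \<Sum>y\<in>H. measure_pmf.prob ?P {S. x \<in> S \<and> y \<in> S})"
    by (simp add: Bochner_Integration.integral_sum integrable)
  \<comment> \<open>Off the diagonal the terms are exactly \<open>1 / 4 ^ i\<close>. Adding this on
    the diagonal too is an overcount that lets the double sum become
    \<open>\<mu> + \<mu>\<^sup>2\<close>.\<close>
  also have "\<dots> \<le> (\<Sum>x\<in>H. \<Sum>y\<in>H. (if x = y then 1 / 2 ^ i else 0) + 1 / 4 ^ i)"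
    by (intro sum_mono) (auto simp: prob_pair_random_solutions prob_mem_random_solutions)
  also have "\<dots> = real (card H) / 2 ^ i + real (card H) * real (card H) / 4 ^ i"
    by (simp add: sum.distrib distrib_left)
  also have "\<dots> = \<mu> + \<mu>\<^sup>2"
    by (simp add: \<mu>_def power2_eq_square flip: power_mult_distrib)
  finally have second: "measure_pmf.expectation ?P (\<lambda>S. N S ^ 2) \<le> \<mu> + \<mu>\<^sup>2" .
  have "measure_pmf.prob ?P {S. S \<inter> H = {}}
      = measure_pmf.expectation ?P (indicator {S. S \<inter> H = {}})"
    by simp
  also have "\<dots> \<le> measure_pmf.expectation ?P (\<lambda>S. 1 - 2 / \<mu> * N S + 1 / \<mu>\<^sup>2 * N S ^ 2)"
  proof (intro integral_mono integrable)
    fix S :: "(bit^'n) set"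
    have "0 \<le> (1 - N S / \<mu>) ^ 2"
      by simp
    then have "0 \<le> 1 - 2 / \<mu> * N S + 1 / \<mu>\<^sup>2 * N S ^ 2"
      by (simp add: power2_eq_square algebra_simps)
    moreover have "N S = 0" if "S \<inter> H = {}"
      using that by (auto simp: N_def indicator_def intro!: sum.neutral)
    ultimately show "indicator {S. S \<inter> H = {}} S \<le> 1 - 2 / \<mu> * N S + 1 / \<mu>\<^sup>2 * N S ^ 2"
      by (auto simp: indicator_def)
  qed
  also have "\<dots> = 1 - 2 / \<mu> * measure_pmf.expectation ?P N
      + 1 / \<mu>\<^sup>2 * measure_pmf.expectation ?P (\<lambda>S. N S ^ 2)"
    by (simp add: integrable)
  \<comment> \<open>The first moment has a negative coefficient and enters with its exact value; for
    the second, whose coefficient is positive, an upper bound suffices.\<close>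
  also have "\<dots> \<le> 1 - 2 / \<mu> * \<mu> + 1 / \<mu>\<^sup>2 * (\<mu> + \<mu>\<^sup>2)"
    unfolding first by (intro add_left_mono mult_left_mono second) simp
  also have "\<dots> = 1 / \<mu>"
    using \<mu> by (simp add: field_simps power2_eq_square)
  finally show ?thesis
    by (simp add: \<mu>_def)
qed

text \<open>Markov's inequality: the indicator of the event is at most the optimum times
  \<open>2 ^ i / (4 * Z)\<close>, a variable of mean at most \<open>1 / 4\<close>.\<close>

lemma prob_projected_optimum_large:
  fixes \<phi> :: "bit^'n \<Rightarrow> real^'d"
  shows "measure_pmf.prob (random_solutions i)
    {S. \<not> projected_optimum \<theta> \<phi> Q S * 2 ^ i \<le> 4 * partition_function \<theta> \<phi>} \<le> 1 / 4"
proof -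
  define Z where "Z = partition_function \<theta> \<phi>"
  have Z: "Z > 0"
    unfolding Z_def partition_function_def by (intro sum_pos) auto
  let ?P = "random_solutions i :: (bit^'n) set pmf"
  have integrable: "integrable ?P f" for f :: "(bit^'n) set \<Rightarrow> real"
    by (rule integrable_measure_pmf_finite) auto
  have "measure_pmf.prob ?P {S. \<not> projected_optimum \<theta> \<phi> Q S * 2 ^ i \<le> 4 * Z}
      = measure_pmf.expectation ?P (indicator {S. \<not> projected_optimum \<theta> \<phi> Q S * 2 ^ i \<le> 4 * Z})"
    by simp
  also have "\<dots> \<le> measure_pmf.expectation ?P (\<lambda>S. projected_optimum \<theta> \<phi> Q S * 2 ^ i / (4 * Z))"
    using Z by (intro integral_mono integrable)
      (auto simp: indicator_def not_le field_simps projected_optimum_nonneg)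
  also have "\<dots> = measure_pmf.expectation ?P (projected_optimum \<theta> \<phi> Q) * 2 ^ i / (4 * Z)"
    by (simp add: integrable)
  also have "\<dots> \<le> Z / (4 * Z)"
    using Z expectation_projected_optimum_le[of i \<theta> \<phi> Q]
    by (intro divide_right_mono) (auto simp: Z_def)
  finally show ?thesis
    using Z by (simp add: Z_def)
qed

text \<open>The witness \<open>m = k - 5\<close> is a truncated subtraction: for \<open>k < 5\<close> there are no constraints at all, and
  then the largest weight suffices.\<close>
lemma ex_prob_projected_optimum_small:
  fixes \<phi> :: "bit^'n \<Rightarrow> real^'d"
  assumes "point_masses \<subseteq> Q"
  shows "\<exists>m\<le>CARD('n). measure_pmf.prob (random_solutions m)
    {S. \<not> partition_function \<theta> \<phi> / (32 * (real CARD('n) + 1)) \<le> projected_optimum \<theta> \<phi> Q S * 2 ^ m} \<le> 1 / 4"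
proof -
  define Z n where "Z = partition_function \<theta> \<phi>" and "n = CARD('n)"
  have Z: "Z > 0"
    unfolding Z_def partition_function_def by (intro sum_pos) auto
  obtain k where k: "k \<le> n" "2 ^ k \<le> card {x. Z / ((real n + 1) * 2 ^ k) \<le> exp (\<theta> \<bullet> \<phi> x)}"
    using heavy_level_exists[where n = n and Z = Z and w = "\<lambda>x. exp (\<theta> \<bullet> \<phi> x)"] Z
    by (auto simp: Z_def partition_function_def n_def)
  define H where "H = {x. Z / ((real n + 1) * 2 ^ k) \<le> exp (\<theta> \<bullet> \<phi> x)}"
  have card_H: "2 ^ k \<le> card H"
    using k by (simp add: H_def)
  then have H: "H \<noteq> {}"
    by auto
  define m where "m = k - 5"
  have "(2::real) ^ k \<le> 2 ^ (5 + m)"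
    by (rule power_increasing) (auto simp: m_def)
  then have pow: "(2::real) ^ k \<le> 32 * 2 ^ m"
    by (simp add: power_add)
  \<comment> \<open>A single surviving element of \<open>H\<close> is enough; replacing
    \<open>2 ^ k\<close> by \<open>32 * 2 ^ m\<close> in its weight bound produces the constant
    32.\<close>
  have good: "Z / (32 * (real n + 1)) \<le> projected_optimum \<theta> \<phi> Q S * 2 ^ m" if meets: "S \<inter> H \<noteq> {}" for S
  proof -
    obtain x where x: "x \<in> S" "x \<in> H"
      using meets by auto
    have "Z / (32 * (real n + 1)) = Z / ((real n + 1) * (32 * 2 ^ m)) * 2 ^ m"
      by simp
    also have "\<dots> \<le> Z / ((real n + 1) * 2 ^ k) * 2 ^ m"
      using Z pow by (intro mult_right_mono divide_left_mono mult_left_mono mult_pos_pos) auto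
    also have "\<dots> \<le> exp (\<theta> \<bullet> \<phi> x) * 2 ^ m"
      using x by (intro mult_right_mono) (auto simp: H_def)
    also have "\<dots> \<le> projected_optimum \<theta> \<phi> Q S * 2 ^ m"
      using x assms by (intro mult_right_mono projected_optimum_ge) auto
    finally show ?thesis .
  qed
  have "measure_pmf.prob (random_solutions m) {S. S \<inter> H = {}} \<le> 1 / 4"
  proof (cases "k \<ge> 5")
    case True
    have "(2::real) ^ k = 2 ^ (5 + m)"
      using True by (simp add: m_def)
    then have "32 * 2 ^ m \<le> real (card H)"
      using card_H of_nat_mono[OF card_H, where 'a = real] by (simp add: power_add)
    \<comment> \<open>The quotient is even at most \<open>1 / 32\<close>; it is relaxed to the
      \<open>1 / 4\<close> that the majority argument takes for both failures.\<close>
    then have "2 ^ m / real (card H) \<le> 1 / 4"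
      using H by (simp add: field_simps card_gt_0_iff)
    then show ?thesis
      using prob_no_solution_in[OF H, of m] by linarith
  next
    case False
    then have "m = 0"
      by (simp add: m_def)
    obtain x where x: "x \<in> H"
      using H by auto
    have "measure_pmf.prob (random_solutions m) {S. S \<inter> H = {}}
        \<le> measure_pmf.prob (random_solutions m) (- {S. x \<in> S})"
      using x by (intro measure_pmf.finite_measure_mono) auto
    also have "\<dots> = 0"
      using measure_pmf.prob_compl[of "{S. x \<in> S}" "random_solutions m"] \<open>m = 0\<close>
      by (simp add: prob_mem_random_solutions Compl_eq_Diff_UNIV)
    finally show ?thesis
      by simp
  qed
  moreover have "measure_pmf.prob (random_solutions m)
      {S. \<not> Z / (32 * (real n + 1)) \<le> projected_optimum \<theta> \<phi> Q S * 2 ^ m}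
      \<le> measure_pmf.prob (random_solutions m) {S. S \<inter> H = {}}"
    using good by (intro measure_pmf.finite_measure_mono) auto
  ultimately show ?thesis
    using k by (intro exI[of _ m]) (auto simp: m_def Z_def n_def)
qed

section \<open>Events of finitely many independent trials\<close>

context prob_space
begin

text \<open>The event is a finite union, over the value patterns \<open>g\<close> on
  \<open>J\<close> that satisfy \<open>P\<close>, of finite intersections of events. This covers
  properties involving \<open>median\<close> without any study of it as a measurable
  function.\<close>

lemma finite_range_event_measurable:
  fixes Y :: "'t \<Rightarrow> 'a \<Rightarrow> 's::finite"
  assumes Y: "\<And>t. t \<in> J \<Longrightarrow> random_variable (count_space UNIV) (Y t)" and J: "finite J"
    and P: "\<And>f g. (\<And>t. t \<in> J \<Longrightarrow> f t = g t) \<Longrightarrow> P f = P g"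
  shows "{\<omega> \<in> space M. P (\<lambda>t. Y t \<omega>)} \<in> events"
proof -
  have "{\<omega> \<in> space M. P (\<lambda>t. Y t \<omega>)}
      = {\<omega> \<in> space M. \<exists>g\<in>{g \<in> J \<rightarrow>\<^sub>E UNIV. P g}. \<forall>t\<in>J. Y t \<omega> = g t}"
  proof (intro Collect_cong conj_cong refl)
    fix \<omega>
    show "P (\<lambda>t. Y t \<omega>) \<longleftrightarrow> (\<exists>g\<in>{g \<in> J \<rightarrow>\<^sub>E UNIV. P g}. \<forall>t\<in>J. Y t \<omega> = g t)"
    proof
      assume "P (\<lambda>t. Y t \<omega>)"
      then have "P (restrict (\<lambda>t. Y t \<omega>) J)"
        by (subst P[of _ "\<lambda>t. Y t \<omega>"]) auto
      then show "\<exists>g\<in>{g \<in> J \<rightarrow>\<^sub>E UNIV. P g}. \<forall>t\<in>J. Y t \<omega> = g t"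
        by (intro bexI[of _ "restrict (\<lambda>t. Y t \<omega>) J"]) auto
    next
      assume "\<exists>g\<in>{g \<in> J \<rightarrow>\<^sub>E UNIV. P g}. \<forall>t\<in>J. Y t \<omega> = g t"
      then show "P (\<lambda>t. Y t \<omega>)"
        using P by (metis (mono_tags, lifting) mem_Collect_eq)
    qed
  qed
  also have "\<dots> \<in> events"
  proof (intro sets.sets_Collect_finite_Ex sets.sets_Collect_finite_All J)
    show "finite {g \<in> J \<rightarrow>\<^sub>E (UNIV :: 's set). P g}"
      using J by (intro finite_subset[OF _ finite_PiE[of J "\<lambda>_. UNIV :: 's set"]]) auto
    show "{\<omega> \<in> space M. Y t \<omega> = g t} \<in> events" if "t \<in> J" for g t
    proof -
      have "Y t -` {g t} \<inter> space M \<in> events"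
        using Y[OF that] by (rule measurable_sets) simp
      moreover have "Y t -` {g t} \<inter> space M = {\<omega> \<in> space M. Y t \<omega> = g t}"
        by auto
      ultimately show ?thesis
        by simp
    qed
  qed
  finally show ?thesis .
qed

text \<open>The count of occurrences is a sum of independent indicators with mean at most
  \<open>T / 4\<close>, where \<open>T = card J\<close>. Reaching \<open>T / 2\<close> is a
  deviation of at least \<open>T / 4\<close>, for which Hoeffding's inequality gives
  \<open>exp (- 2 * (T / 4)\<^sup>2 / T) = exp (- T / 8)\<close>.\<close>

lemma indep_majority_bound:
  fixes Y :: "'t \<Rightarrow> 'a \<Rightarrow> 's"
  assumes indep: "indep_vars (\<lambda>_. count_space UNIV) Y J" and J: "finite J" "J \<noteq> {}"
    and quarter: "\<And>t. t \<in> J \<Longrightarrow> prob {\<omega> \<in> space M. P (Y t \<omega>)} \<le> 1 / 4"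
  shows "prob {\<omega> \<in> space M. card J \<le> 2 * card {t \<in> J. P (Y t \<omega>)}} \<le> exp (- real (card J) / 8)"
proof -
  define X where "X t \<omega> = (indicator {y. P y} (Y t \<omega>) :: real)" for t \<omega>
  have indep_X: "indep_vars (\<lambda>_. borel) X J"
    unfolding X_def by (rule indep_vars_compose2[OF indep]) auto
  interpret H: Hoeffding_ineq M J X "\<lambda>_. 0" "\<lambda>_. 1" "\<Sum>t\<in>J. expectation (X t)"
    by unfold_locales (auto simp: J indep_X X_def indicator_def)
  define T where "T = real (card J)"
  have T: "T > 0"
    using J by (simp add: T_def card_gt_0_iff)
  have mean: "expectation (X t) \<le> 1 / 4" if "t \<in> J" for t
  proof -
    have "Y t \<in> measurable M (count_space UNIV)"
      using indep that by (simp add: indep_vars_def)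
    then have ev: "Y t -` {y. P y} \<inter> space M \<in> events"
      by (rule measurable_sets) simp
    have eq: "Y t -` {y. P y} \<inter> space M = {\<omega> \<in> space M. P (Y t \<omega>)}"
      by auto
    have "expectation (X t) = expectation (indicator {\<omega> \<in> space M. P (Y t \<omega>)})"
      by (intro Bochner_Integration.integral_cong) (auto simp: X_def indicator_def)
    then show ?thesis
      using quarter[OF that] ev unfolding eq by simp
  qed
  have "(\<Sum>t\<in>J. expectation (X t)) \<le> (\<Sum>t\<in>J. 1 / 4)"
    by (intro sum_mono mean)
  then have mean_sum: "(\<Sum>t\<in>J. expectation (X t)) \<le> T / 4"
    by (simp add: T_def)
  have sum_X: "(\<Sum>t\<in>J. X t \<omega>) = real (card {t \<in> J. P (Y t \<omega>)})" for \<omega>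
    by (simp add: X_def indicator_def J sum.If_cases Int_def)
  have [measurable]: "X t \<in> borel_measurable M" if "t \<in> J" for t
    using indep_X that by (simp add: indep_vars_def)
  have "prob {\<omega> \<in> space M. card J \<le> 2 * card {t \<in> J. P (Y t \<omega>)}}
      \<le> prob {\<omega> \<in> space M. (\<Sum>t\<in>J. expectation (X t)) + T / 4 \<le> (\<Sum>t\<in>J. X t \<omega>)}"
  proof (rule finite_measure_mono)
    show "{\<omega> \<in> space M. card J \<le> 2 * card {t \<in> J. P (Y t \<omega>)}}
        \<subseteq> {\<omega> \<in> space M. (\<Sum>t\<in>J. expectation (X t)) + T / 4 \<le> (\<Sum>t\<in>J. X t \<omega>)}"
      using mean_sum by (auto simp: sum_X T_def)
  qed measurable
  also have "\<dots> \<le> exp (- 2 * (T / 4)\<^sup>2 / (\<Sum>t\<in>J. (1 - 0)\<^sup>2))"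
    using T by (intro H.Hoeffding_ineq_ge) (auto simp: T_def)
  also have "- 2 * (T / 4)\<^sup>2 / (\<Sum>t\<in>J. (1 - 0)\<^sup>2) = - T / 8"
    using T by (simp add: power2_eq_square flip: T_def)
  finally show ?thesis
    by (simp add: T_def)
qed

lemma prob_indep_uniform_bits:
  fixes X :: "'k \<Rightarrow> 'a \<Rightarrow> bit"
  assumes indep: "indep_vars (\<lambda>_. count_space UNIV) X I"
    and unif: "\<And>k. k \<in> I \<Longrightarrow>
      distr M (count_space UNIV) (X k) = measure_pmf (map_pmf of_bool (bernoulli_pmf (1 / 2)))"
    and K: "finite K" "K \<subseteq> I"
  shows "prob {\<omega> \<in> space M. \<forall>k\<in>K. X k \<omega> = v k} = 1 / 2 ^ card K"
proof (cases "K = {}")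
  \<comment> \<open>This case occurs for \<open>i = 0\<close>; the intersection used below would
    then be the whole type instead of \<open>space M\<close>.\<close>
  case True
  then show ?thesis
    by (simp add: prob_space)
next
  case False
  have "{\<omega> \<in> space M. \<forall>k\<in>K. X k \<omega> = v k} = (\<Inter>k\<in>K. X k -` {v k} \<inter> space M)"
    using False by auto
  also have "prob \<dots> = (\<Prod>k\<in>K. prob (X k -` {v k} \<inter> space M))"
    using False K by (intro indep_varsD[OF indep]) auto
  also have "\<dots> = (\<Prod>k\<in>K. 1 / 2)"
  proof (intro prod.cong refl)
    fix k assume k: "k \<in> K"
    have rv: "X k \<in> measurable M (count_space UNIV)"
      using indep k K by (auto simp: indep_vars_def)
    have "prob (X k -` {v k} \<inter> space M) = measure (distr M (count_space UNIV) (X k)) {v k}"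
      by (rule measure_distr[OF rv, symmetric]) simp
    also have "\<dots> = pmf (map_pmf of_bool (bernoulli_pmf (1 / 2))) (v k)"
      using k K unif[of k] by (auto simp: measure_pmf_single)
    also have "\<dots> = 1 / 2"
    proof -
      have "v k = of_bool (v k = 1)"
        by (cases "v k") auto
      then show ?thesis
        using pmf_map_inj'[of "of_bool :: bool \<Rightarrow> bit" "bernoulli_pmf (1 / 2)" "v k = 1"]
        by (cases "v k = 1") (auto simp: inj_def)
    qed
    finally show "prob (X k -` {v k} \<inter> space M) = 1 / 2" .
  qed
  finally show ?thesis
    by (simp add: power_one_over)
qed

end

section \<open>From random entries to random solution sets\<close>

text \<open>The solution sets of different trials are functions of disjoint blocks
  \<open>K t\<close> of entries, hence independent. Each concrete system is drawn with the same
  probability \<open>1 / 2 ^ (i * (CARD('n) + 1))\<close>, which is the uniform law of the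
  model.\<close>

lemma random_parity_constraints_solutions:
  fixes M :: "'w measure" and A :: "nat \<Rightarrow> nat \<Rightarrow> 'w \<Rightarrow> nat \<Rightarrow> bit^'n"
  assumes "random_parity_constraints M T A b" and i: "i \<le> CARD('n)"
  defines "S \<equiv> \<lambda>t \<omega>. parity_solutions i (A i t \<omega>) (b i t \<omega>)"
  shows "prob_space.indep_vars M (\<lambda>_. count_space UNIV) S {1..T}"
    and "t \<in> {1..T} \<Longrightarrow> distr M (count_space UNIV) (S t) = measure_pmf (random_solutions i)"
proof -
  define X :: "(nat \<times> nat \<times> nat \<times> 'n) + (nat \<times> nat \<times> nat) \<Rightarrow> 'w \<Rightarrow> bit"
    where "X = case_sum (\<lambda>(i, t, r, c) \<omega>. A i t \<omega> r $ c) (\<lambda>(i, t, r) \<omega>. b i t \<omega> r)"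
  define I :: "((nat \<times> nat \<times> nat \<times> 'n) + (nat \<times> nat \<times> nat)) set"
    where "I = {(i, t, r, c). i \<le> CARD('n) \<and> t \<in> {1..T} \<and> r < i}
              <+> {(i, t, r). i \<le> CARD('n) \<and> t \<in> {1..T} \<and> r < i}"
  have "prob_space M" and indep: "prob_space.indep_vars M (\<lambda>_. count_space UNIV) X I"
    and unif: "\<And>k. k \<in> I \<Longrightarrow>
      distr M (count_space UNIV) (X k) = measure_pmf (map_pmf of_bool (bernoulli_pmf (1 / 2)))"
    using assms(1) unfolding random_parity_constraints_def Let_def X_def I_def by auto
  interpret prob_space M
    by fact
  define K :: "nat \<Rightarrow> ((nat \<times> nat \<times> nat \<times> 'n) + (nat \<times> nat \<times> nat)) set"
    where "K t = ({i} \<times> {t} \<times> {..<i} \<times> UNIV) <+> ({i} \<times> {t} \<times> {..<i})" for t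
  have K: "finite (K t)" "card (K t) = i * (CARD('n) + 1)" for t
    by (auto simp: K_def card_Plus card_cartesian_product)
  have K_sub: "K t \<subseteq> I" if "t \<in> {1..T}" for t
    using that i by (auto simp: K_def I_def)
  define h where "h t f = parity_solutions i (\<lambda>r. \<chi> c. f (Inl (i, t, r, c))) (\<lambda>r. f (Inr (i, t, r)))"
    for t and f :: "(nat \<times> nat \<times> nat \<times> 'n) + (nat \<times> nat \<times> nat) \<Rightarrow> bit"
  \<comment> \<open>Outside the block the restriction is \<open>undefined\<close>, but
    \<open>parity_solutions i\<close> reads only the rows below \<open>i\<close>.\<close>
  have S_eq: "S t \<omega> = h t (restrict (\<lambda>k. X k \<omega>) (K t))" for t \<omega>
  proof -
    have "(\<chi> c. restrict (\<lambda>k. X k \<omega>) (K t) (Inl (i, t, r, c))) = A i t \<omega> r"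
      "restrict (\<lambda>k. X k \<omega>) (K t) (Inr (i, t, r)) = b i t \<omega> r" if "r < i" for r
      using that by (auto simp: vec_eq_iff K_def X_def)
    then show ?thesis
      by (auto simp: S_def h_def mem_parity_solutions)
  qed
  have "indep_vars (\<lambda>t. PiM (K t) (\<lambda>_. count_space UNIV)) (\<lambda>t \<omega>. restrict (\<lambda>k. X k \<omega>) (K t)) {1..T}"
    using indep K_sub by (rule indep_vars_restrict) (auto simp: disjoint_family_on_def K_def)
  \<comment> \<open>A finite product of finite discrete spaces is discrete, so \<open>h t\<close> is
    measurable like every function on it.\<close>
  then have "indep_vars (\<lambda>_. count_space UNIV) (\<lambda>t \<omega>. h t (restrict (\<lambda>k. X k \<omega>) (K t))) {1..T}"
    by (rule indep_vars_compose2) (simp add: count_space_PiM_finite K(1))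
  then show indep_S: "indep_vars (\<lambda>_. count_space UNIV) S {1..T}"
    by (simp add: S_eq[abs_def])
  assume t: "t \<in> {1..T}"
  have rv: "S t \<in> measurable M (count_space UNIV)"
    using indep_S t by (simp add: indep_vars_def)
  \<comment> \<open>\<open>V g\<close> lays out the system \<open>g\<close> as values of the single
    entries, so that \<open>E g\<close> is the event that trial \<open>t\<close> draws
    \<open>g\<close>.\<close>
  define V :: "(nat \<Rightarrow> (bit^'n) \<times> bit) \<Rightarrow> (nat \<times> nat \<times> nat \<times> 'n) + (nat \<times> nat \<times> nat) \<Rightarrow> bit"
    where "V g = case_sum (\<lambda>(i, t, r, c). fst (g r) $ c) (\<lambda>(i, t, r). snd (g r))" for g
  define E where "E g = {\<omega> \<in> space M. \<forall>k\<in>K t. X k \<omega> = V g k}" for g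
  have E_iff: "\<omega> \<in> E g \<longleftrightarrow> \<omega> \<in> space M \<and> (\<forall>r<i. g r = (A i t \<omega> r, b i t \<omega> r))" for \<omega> g
    by (auto simp: E_def K_def X_def V_def vec_eq_iff prod_eq_iff ball_Un Plus_def)
  have E_events: "E g \<in> events" for g
  proof -
    have "X k -` {V g k} \<inter> space M \<in> events" if "k \<in> K t" for k
    proof (rule measurable_sets)
      show "X k \<in> measurable M (count_space UNIV)"
        using indep that K_sub[OF t] by (auto simp: indep_vars_def)
    qed simp
    moreover have "X k -` {V g k} \<inter> space M = {\<omega> \<in> space M. X k \<omega> = V g k}" for k
      by auto
    ultimately show ?thesis
      unfolding E_def by (intro sets.sets_Collect_finite_All K) auto
  qed
  have prob_E: "prob (E g) = 1 / 2 ^ (i * (CARD('n) + 1))" for g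
    unfolding E_def K(2)[of t, symmetric]
    by (rule prob_indep_uniform_bits[OF indep unif K(1) K_sub[OF t]])
  let ?\<Omega> = "{..<i} \<rightarrow>\<^sub>E (UNIV :: ((bit^'n) \<times> bit) set)"
  let ?sol = "\<lambda>g. parity_solutions i (fst \<circ> g) (snd \<circ> g)"
  have law: "prob (S t -` {s} \<inter> space M) = pmf (random_solutions i) s" for s
  proof -
    have sol_E: "S t \<omega> = ?sol g" if "\<omega> \<in> E g" for \<omega> g
      using that by (auto simp: E_iff S_def mem_parity_solutions)
    \<comment> \<open>Distinct extensional systems differ in some row below \<open>i\<close>, so
      this union is disjoint. Its parts are equally likely, and their number over that of all
      systems is the probability in the model.\<close>
    have "S t -` {s} \<inter> space M = (\<Union>g\<in>?\<Omega> \<inter> {g. ?sol g = s}. E g)"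
    proof (intro equalityI subsetI)
      fix \<omega> assume \<omega>: "\<omega> \<in> S t -` {s} \<inter> space M"
      define g where "g = restrict (\<lambda>r. (A i t \<omega> r, b i t \<omega> r)) {..<i}"
      have "\<omega> \<in> E g"
        using \<omega> by (auto simp: E_iff g_def)
      moreover have "g \<in> ?\<Omega> \<inter> {g. ?sol g = s}"
        using \<omega> sol_E[OF \<open>\<omega> \<in> E g\<close>] by (auto simp: g_def)
      ultimately show "\<omega> \<in> (\<Union>g\<in>?\<Omega> \<inter> {g. ?sol g = s}. E g)"
        by blast
    qed (use sol_E E_iff in blast)
    also have "prob \<dots> = (\<Sum>g\<in>?\<Omega> \<inter> {g. ?sol g = s}. prob (E g))"
    proof (rule finite_measure_finite_Union)
      show "disjoint_family_on E (?\<Omega> \<inter> {g. ?sol g = s})"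
        unfolding disjoint_family_on_def
      proof (intro ballI impI)
        fix g g' assume "g \<in> ?\<Omega> \<inter> {g. ?sol g = s}" "g' \<in> ?\<Omega> \<inter> {g. ?sol g = s}" and "g \<noteq> g'"
        then have "\<not> (\<forall>r\<in>{..<i}. g r = g' r)"
          using PiE_ext[of g "{..<i}" "\<lambda>_. UNIV" g'] by blast
        then obtain r where "r < i" "g r \<noteq> g' r"
          by blast
        then show "E g \<inter> E g' = {}"
          by (auto simp: E_iff)
      qed
      show "finite (?\<Omega> \<inter> {g. ?sol g = s})"
        by (intro finite_Int disjI1 constraint_systems_finite_nonempty)
      show "E ` (?\<Omega> \<inter> {g. ?sol g = s}) \<subseteq> events"
        using E_events by blast
    qed
    also have "\<dots> = pmf (random_solutions i) s"
    proof -
      have "pmf (random_solutions i) s = real (card (?\<Omega> \<inter> {g. ?sol g = s})) / real (card ?\<Omega>)"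
        unfolding random_solutions_def pmf_map
        by (subst measure_pmf_of_set)
          (simp_all only: constraint_systems_finite_nonempty vimage_def singleton_iff not_False_eq_True)
      then show ?thesis
        unfolding prob_E card_constraint_systems by simp
    qed
    finally show ?thesis .
  qed
  show "distr M (count_space UNIV) (S t) = measure_pmf (random_solutions i)"
  proof (rule measure_eqI_finite[of _ UNIV])
    fix s
    show "emeasure (distr M (count_space UNIV) (S t)) {s} = emeasure (measure_pmf (random_solutions i)) {s}"
      using rv law[of s] by (simp add: emeasure_distr emeasure_eq_measure emeasure_pmf_single)
  qed simp_all
qed

text \<open>Transfers the single-trial bounds from the model to \<open>M\<close>. Integrability is
  automatic because there are only finitely many solution sets.\<close>

lemma random_parity_constraints_law:
  fixes M :: "'w measure" and A :: "nat \<Rightarrow> nat \<Rightarrow> 'w \<Rightarrow> nat \<Rightarrow> bit^'n" and f :: "(bit^'n) set \<Rightarrow> real"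
  assumes "random_parity_constraints M T A b" "i \<le> CARD('n)" "t \<in> {1..T}"
  shows "integrable M (\<lambda>\<omega>. f (parity_solutions i (A i t \<omega>) (b i t \<omega>)))" (is ?integrable)
    and "(\<integral>\<omega>. f (parity_solutions i (A i t \<omega>) (b i t \<omega>)) \<partial>M)
      = measure_pmf.expectation (random_solutions i) f" (is ?expectation)
    and "measure M {\<omega> \<in> space M. P (parity_solutions i (A i t \<omega>) (b i t \<omega>))}
      = measure_pmf.prob (random_solutions i) {S. P S}" (is ?prob)
proof -
  interpret prob_space M
    using assms(1) by (simp add: random_parity_constraints_def Let_def)
  let ?S = "\<lambda>\<omega>. parity_solutions i (A i t \<omega>) (b i t \<omega>)"
  have rv: "?S \<in> measurable M (count_space UNIV)"
    using random_parity_constraints_solutions(1)[OF assms(1,2)] assms(3)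
    by (simp add: indep_vars_def)
  have law: "distr M (count_space UNIV) ?S = measure_pmf (random_solutions i)"
    by (rule random_parity_constraints_solutions(2)[OF assms])
  show ?integrable
    by (rule integrable_distr[OF rv]) (auto simp: law intro: integrable_measure_pmf_finite)
  show ?expectation
    unfolding law[symmetric] by (rule integral_distr[OF rv, symmetric]) simp
  have "measure_pmf.prob (random_solutions i) {S. P S} = prob (?S -` {S. P S} \<inter> space M)"
    unfolding law[symmetric] by (rule measure_distr[OF rv]) simp
  also have "?S -` {S. P S} \<inter> space M = {\<omega> \<in> space M. P (?S \<omega>)}"
    by auto
  finally show ?prob
    by simp
qed

section \<open>Assembly of the expectation and probability bounds\<close>

text \<open>Since \<open>\<alpha> \<le> 1 / 8\<close> and \<open>n \<ge> 1\<close>, the chain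
  \<open>T / 8 \<ge> \<alpha> * T \<ge> ln (n / \<delta>) \<ge> ln (1 / \<delta>)\<close>
  holds.\<close>

lemma exp_neg_eighth_le:
  fixes T :: real
  assumes "\<delta> > 0" "0 < \<alpha>" "\<alpha> \<le> 0.0042" "T \<ge> 1 / \<alpha> * ln (real n / \<delta>)" "n \<ge> 1" "T \<ge> 0"
  shows "exp (- T / 8) \<le> \<delta>"
proof -
  have "ln (1 / \<delta>) \<le> ln (real n / \<delta>)"
    using assms by (simp add: divide_right_mono)
  also have "\<dots> \<le> \<alpha> * T"
    using assms by (simp add: field_simps)
  also have "\<dots> \<le> 1 / 8 * T"
    using assms by (intro mult_right_mono) auto
  finally have "- T / 8 \<le> ln \<delta>"
    using assms by (simp add: ln_div)
  then show ?thesis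
    using assms by (metis exp_le_cancel_iff exp_ln)
qed

theorem theorem1:
  fixes \<theta> :: "real^'d" and \<phi> :: "bit^'n \<Rightarrow> real^'d"
    and p :: "(bit^'n) pmf" and Q :: "(bit^'n) pmf set"
    and Z :: real
    and \<gamma> :: "(nat \<Rightarrow> nat \<Rightarrow> 'w \<Rightarrow> nat \<Rightarrow> bit^'n) \<Rightarrow> (nat \<Rightarrow> nat \<Rightarrow> 'w \<Rightarrow> nat \<Rightarrow> bit) \<Rightarrow>
                nat \<Rightarrow> nat \<Rightarrow> 'w \<Rightarrow> real"
  defines "Z \<equiv> partition_function \<theta> \<phi>"
    and "\<gamma> \<equiv> \<lambda>A b i t \<omega>. projected_optimum \<theta> \<phi> Q (parity_solutions i (A i t \<omega>) (b i t \<omega>))"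
  assumes "\<forall>x. pmf p x = exp (\<theta> \<bullet> \<phi> x) / Z"
    and "point_masses \<subseteq> Q"
  shows
    "(\<forall>(M :: 'w measure) T A b.
        T \<ge> 1 \<and> random_parity_constraints M T A b \<longrightarrow>
        (\<forall>i \<in> {0..CARD('n)}. \<forall>t \<in> {1..T}.
           (\<integral>\<omega>. 1 / real T * (\<Sum>s = 1..T. \<gamma> A b i s \<omega> * 2 ^ i) \<partial>M)
             = (\<integral>\<omega>. \<gamma> A b i t \<omega> * 2 ^ i \<partial>M) \<and>
           (\<integral>\<omega>. \<gamma> A b i t \<omega> * 2 ^ i \<partial>M) \<le> Z))
     \<and>
     (\<exists>m \<in> {0..CARD('n)}. \<forall>\<delta> > 0. \<forall>\<alpha>. 0 < \<alpha> \<and> \<alpha> \<le> 0.0042 \<longrightarrow>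
        (\<forall>T \<ge> 1. real T \<ge> 1 / \<alpha> * ln (real CARD('n) / \<delta>) \<longrightarrow>
          (\<forall>(M :: 'w measure) A b. random_parity_constraints M T A b \<longrightarrow>
             measure M {\<omega> \<in> space M.
               1 / real T * (\<Sum>t = 1..T. \<gamma> A b m t \<omega> * 2 ^ m) \<ge> Z / (64 * (real CARD('n) + 1)) \<and>
               4 * Z \<ge> median (map (\<lambda>t. \<gamma> A b m t \<omega>) [1..<Suc T]) * 2 ^ m \<and>
               median (map (\<lambda>t. \<gamma> A b m t \<omega>) [1..<Suc T]) * 2 ^ m \<ge> Z / (32 * (real CARD('n) + 1))}
             \<ge> 1 - 2 * \<delta>)))"
proof (intro conjI allI impI ballI)
  fix M :: "'w measure" and T and A :: "nat \<Rightarrow> nat \<Rightarrow> 'w \<Rightarrow> nat \<Rightarrow> bit^'n" and b i t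
  assume "1 \<le> T \<and> random_parity_constraints M T A b" and "i \<in> {0..CARD('n)}" and t: "t \<in> {1..T}"
  then have T: "T \<ge> 1" and R: "random_parity_constraints M T A b" and i: "i \<le> CARD('n)"
    by auto
  note transfer = random_parity_constraints_law(1,2)[OF R i, of _ "projected_optimum \<theta> \<phi> Q"]
  define e where "e = measure_pmf.expectation (random_solutions i) (projected_optimum \<theta> \<phi> Q)"
  \<comment> \<open>The law of the solution set does not depend on the trial, so all trials share
    one mean and averaging leaves it unchanged.\<close>
  have mean: "(\<integral>\<omega>. \<gamma> A b i s \<omega> * 2 ^ i \<partial>M) = e * 2 ^ i" if "s \<in> {1..T}" for s
    using transfer[OF that] by (simp add: \<gamma>_def e_def)
  have "(\<integral>\<omega>. (\<Sum>s = 1..T. \<gamma> A b i s \<omega> * 2 ^ i) \<partial>M) = (\<Sum>s = 1..T. \<integral>\<omega>. \<gamma> A b i s \<omega> * 2 ^ i \<partial>M)"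
    using transfer(1) by (intro Bochner_Integration.integral_sum integrable_mult_left) (auto simp: \<gamma>_def)
  then show "(\<integral>\<omega>. 1 / real T * (\<Sum>s = 1..T. \<gamma> A b i s \<omega> * 2 ^ i) \<partial>M) = (\<integral>\<omega>. \<gamma> A b i t \<omega> * 2 ^ i \<partial>M)"
    using T mean t by simp
  show "(\<integral>\<omega>. \<gamma> A b i t \<omega> * 2 ^ i \<partial>M) \<le> Z"
    unfolding mean[OF t] e_def Z_def by (rule expectation_projected_optimum_le)
next
  define L where "L = Z / (32 * (real CARD('n) + 1))"
  have L: "L \<ge> 0"
    by (simp add: L_def Z_def partition_function_def sum_nonneg)
  \<comment> \<open>The choice is made in the model, from \<open>\<theta>\<close>,
    \<open>\<phi>\<close> and \<open>Q\<close> alone, and therefore serves all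
    \<open>\<delta>\<close>, \<open>\<alpha>\<close>, \<open>T\<close> and \<open>M\<close>.\<close>
  obtain m where m: "m \<le> CARD('n)"
    and small: "measure_pmf.prob (random_solutions m) {S. \<not> L \<le> projected_optimum \<theta> \<phi> Q S * 2 ^ m} \<le> 1 / 4"
    using ex_prob_projected_optimum_small[OF assms(4), of \<theta> \<phi>] by (auto simp: L_def Z_def)
  have "1 - 2 * \<delta> \<le> measure M {\<omega> \<in> space M.
      1 / real T * (\<Sum>t = 1..T. \<gamma> A b m t \<omega> * 2 ^ m) \<ge> Z / (64 * (real CARD('n) + 1)) \<and>
      4 * Z \<ge> median (map (\<lambda>t. \<gamma> A b m t \<omega>) [1..<Suc T]) * 2 ^ m \<and>
      median (map (\<lambda>t. \<gamma> A b m t \<omega>) [1..<Suc T]) * 2 ^ m \<ge> Z / (32 * (real CARD('n) + 1))}"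
    (is "_ \<le> measure M ?good")
    if \<delta>: "\<delta> > 0" and \<alpha>: "0 < \<alpha>" "\<alpha> \<le> 0.0042" and T: "T \<ge> 1" "real T \<ge> 1 / \<alpha> * ln (real CARD('n) / \<delta>)"
      and R: "random_parity_constraints M T A b"
    for \<delta> \<alpha> T b and M :: "'w measure" and A :: "nat \<Rightarrow> nat \<Rightarrow> 'w \<Rightarrow> nat \<Rightarrow> bit^'n"
  proof -
    interpret prob_space M
      using R by (simp add: random_parity_constraints_def Let_def)
    define S where "S t \<omega> = parity_solutions m (A m t \<omega>) (b m t \<omega>)" for t \<omega>
    define g where "g s = projected_optimum \<theta> \<phi> Q s * 2 ^ m" for s
    have \<gamma>_eq: "\<gamma> A b m t \<omega> = projected_optimum \<theta> \<phi> Q (S t \<omega>)" for t \<omega>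
      by (simp add: \<gamma>_def S_def)
    have indep: "indep_vars (\<lambda>_. count_space UNIV) S {1..T}"
      using random_parity_constraints_solutions(1)[OF R m] by (simp add: S_def[abs_def])
    then have rv: "random_variable (count_space UNIV) (S t)" if "t \<in> {1..T}" for t
      using that by (simp add: indep_vars_def)
    define bad where "bad P = {\<omega> \<in> space M. T \<le> 2 * card {t \<in> {1..T}. P (S t \<omega>)}}" for P
    have bad_events: "bad P \<in> events" for P
      unfolding bad_def
      by (intro finite_range_event_measurable[where J = "{1..T}" and Y = S
            and P = "\<lambda>f. T \<le> 2 * card {t \<in> {1..T}. P (f t)}"] rv) (auto cong: conj_cong)
    have prob_bad: "prob (bad P) \<le> \<delta>" if "measure_pmf.prob (random_solutions m) {s. P s} \<le> 1 / 4" for P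
    proof -
      have "prob (bad P) \<le> exp (- real T / 8)"
        using indep_majority_bound[OF indep, of P] that T
          random_parity_constraints_law(3)[OF R m, of _ P] by (simp add: bad_def S_def)
      also have "\<dots> \<le> \<delta>"
        using \<delta> \<alpha> T by (intro exp_neg_eighth_le[where n = "CARD('n)"]) auto
      finally show ?thesis .
    qed
    \<comment> \<open>Written as a property of the family of solution sets, with
      \<open>L / 2\<close> as the bound with constant 64, the event fits
      \<open>finite_range_event_measurable\<close>.\<close>
    have good_eq: "?good = {\<omega> \<in> space M.
        (\<lambda>f. 1 / real T * (\<Sum>t = 1..T. g (f t)) \<ge> L / 2 \<and>
          4 * Z \<ge> median (map (\<lambda>t. projected_optimum \<theta> \<phi> Q (f t)) [1..<Suc T]) * 2 ^ m \<and>
          median (map (\<lambda>t. projected_optimum \<theta> \<phi> Q (f t)) [1..<Suc T]) * 2 ^ m \<ge> L) (\<lambda>t. S t \<omega>)}"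
      by (simp add: \<gamma>_eq g_def L_def)
    have good_events: "?good \<in> events"
      unfolding good_eq
    proof (rule finite_range_event_measurable[OF rv])
      fix f f' :: "nat \<Rightarrow> (bit^'n) set" assume eq: "\<And>t. t \<in> {1..T} \<Longrightarrow> f t = f' t"
      then have "map (\<lambda>t. projected_optimum \<theta> \<phi> Q (f t)) [1..<Suc T]
          = map (\<lambda>t. projected_optimum \<theta> \<phi> Q (f' t)) [1..<Suc T]"
        and "(\<Sum>t = 1..T. g (f t)) = (\<Sum>t = 1..T. g (f' t))"
        by (auto intro: sum.cong)
      then show "(1 / real T * (\<Sum>t = 1..T. g (f t)) \<ge> L / 2 \<and>
          4 * Z \<ge> median (map (\<lambda>t. projected_optimum \<theta> \<phi> Q (f t)) [1..<Suc T]) * 2 ^ m \<and>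
          median (map (\<lambda>t. projected_optimum \<theta> \<phi> Q (f t)) [1..<Suc T]) * 2 ^ m \<ge> L) =
        (1 / real T * (\<Sum>t = 1..T. g (f' t)) \<ge> L / 2 \<and>
          4 * Z \<ge> median (map (\<lambda>t. projected_optimum \<theta> \<phi> Q (f' t)) [1..<Suc T]) * 2 ^ m \<and>
          median (map (\<lambda>t. projected_optimum \<theta> \<phi> Q (f' t)) [1..<Suc T]) * 2 ^ m \<ge> L)"
        by presburger
    qed auto
    \<comment> \<open>Off these two events, strict majorities of the trials satisfy the upper and
      the lower bound. This gives both median bounds, and the lower majority also the average, so
      two failures of probability at most \<open>\<delta>\<close> account for all three
      claims.\<close>
    have "space M - ?good \<subseteq> bad (\<lambda>s. \<not> g s \<le> 4 * Z) \<union> bad (\<lambda>s. \<not> L \<le> g s)"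
    proof
      fix \<omega> assume \<omega>: "\<omega> \<in> space M - ?good"
      let ?xs = "map (\<lambda>t. projected_optimum \<theta> \<phi> Q (S t \<omega>)) [1..<Suc T]"
      show "\<omega> \<in> bad (\<lambda>s. \<not> g s \<le> 4 * Z) \<union> bad (\<lambda>s. \<not> L \<le> g s)"
      proof (rule ccontr)
        assume "\<not> ?thesis"
        then have few: "2 * card {t \<in> {1..T}. \<not> g (S t \<omega>) \<le> 4 * Z} < T"
          "2 * card {t \<in> {1..T}. \<not> L \<le> g (S t \<omega>)} < T"
          using \<omega> by (auto simp: bad_def)
        have "median ?xs \<le> 4 * Z / 2 ^ m"
          using few(1) by (intro median_le) (simp only: length_filter_map_upt, simp add: g_def field_simps)
        moreover have "L / 2 ^ m \<le> median ?xs"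
          using few(2) by (intro median_ge) (simp only: length_filter_map_upt, simp add: g_def field_simps)
        moreover have "L / 2 \<le> 1 / real T * (\<Sum>t = 1..T. g (S t \<omega>))"
          using few(2) L by (intro average_ge_half) (auto simp: g_def projected_optimum_nonneg)
        ultimately show False
          using \<omega> unfolding good_eq by (simp add: field_simps)
      qed
    qed
    then have "prob (space M - ?good) \<le> prob (bad (\<lambda>s. \<not> g s \<le> 4 * Z) \<union> bad (\<lambda>s. \<not> L \<le> g s))"
      by (intro finite_measure_mono) (use bad_events in auto)
    also have "\<dots> \<le> prob (bad (\<lambda>s. \<not> g s \<le> 4 * Z)) + prob (bad (\<lambda>s. \<not> L \<le> g s))"
      using bad_events by (intro measure_Un_le)
    also have "\<dots> \<le> \<delta> + \<delta>"
      using small prob_projected_optimum_large[of m \<theta> \<phi> Q]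
      by (intro add_mono prob_bad) (auto simp: g_def Z_def)
    finally show ?thesis
      using good_events by (simp add: prob_compl)
  qed
  then show "\<exists>m \<in> {0..CARD('n)}. \<forall>\<delta> > 0. \<forall>\<alpha>. 0 < \<alpha> \<and> \<alpha> \<le> 0.0042 \<longrightarrow>
        (\<forall>T \<ge> 1. real T \<ge> 1 / \<alpha> * ln (real CARD('n) / \<delta>) \<longrightarrow>
          (\<forall>(M :: 'w measure) A b. random_parity_constraints M T A b \<longrightarrow>
             measure M {\<omega> \<in> space M.
               1 / real T * (\<Sum>t = 1..T. \<gamma> A b m t \<omega> * 2 ^ m) \<ge> Z / (64 * (real CARD('n) + 1)) \<and>
               4 * Z \<ge> median (map (\<lambda>t. \<gamma> A b m t \<omega>) [1..<Suc T]) * 2 ^ m \<and>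
               median (map (\<lambda>t. \<gamma> A b m t \<omega>) [1..<Suc T]) * 2 ^ m \<ge> Z / (32 * (real CARD('n) + 1))}
             \<ge> 1 - 2 * \<delta>))"
    using m by (intro bexI[of _ m] allI impI) auto
qed

end
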